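(* Let $(R,|\cdot|)$ be a normed ring of characteristic different from $2$, with fraction field $K$, and let $q(x_1,\ldots,x_n)$ be a quadratic form over $R$, nondegenerate over $K$. If $q$ is Euclidean with respect to $|\cdot|$, then $q$ is an ADC form.
   Context: $\mathbb{N}$ denotes the non-negative integers (including $0$). A norm on a commutative unital ring $R$ is a function $|\cdot|: R \to \mathbb{N}$ such that (N0) $|x|=0 \iff x=0$; (N1) $|xy|=|x||y|$ for all $x,y\in R$; (N2) $|x|=1 \iff x\in R^{\times}$. A normed ring is a pair $(R,|\cdot|)$ with $|\cdot|$ a norm on $R$; such an $R$ is an integral domain. The norm extends uniquely to the fraction field $K$ by $|x/y| = |x|/|y|$, giving a multiplicative map $K\to\mathbb{Q}_{\ge 0}$. A quadratic form over $R$ is a homogeneous polynomial $q\in R[x_1,\ldots,x_n]$ of degree $2$. A quadratic form $q$ over $(R,|\cdot|)$ is Euclidean if for all $x\in K^n\setminus R^n$ there exists $y\in R^n$ such that $0<|q(x-y)|<1$. A quadratic form $q$ over $R$ is an ADC form if for all $d\in R$: if there exists $x\in K^n$ with $q(x)=d$, then there exists $y\in R^n$ with $q(y)=d$. *)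

theory Defs
  imports
    "HOL-Library.Poly_Mapping"
    "HOL-Computational_Algebra.Polynomial_Factorial"
    "HOL-Analysis.Finite_Cartesian_Product"
begin

definition is_ring_norm :: "('a::comm_ring_1 \<Rightarrow> nat) \<Rightarrow> bool" where
  "is_ring_norm N \<longleftrightarrow>
     (\<forall>x. N x = 0 \<longleftrightarrow> x = 0) \<and>
     (\<forall>x y. N (x * y) = N x * N y) \<and>
     (\<forall>x. N x = 1 \<longleftrightarrow> x dvd 1)"

text \<open>
  A commutative ring carrying a norm is an integral domain, so nothing is lost
  by working below over the type class \<open>idom\<close>, which the type constructor
  \<open>fract\<close> of fraction fields requires.
\<close>

lemma is_ring_norm_eq_0_iff: "is_ring_norm N \<Longrightarrow> N x = 0 \<longleftrightarrow> x = 0"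
  unfolding is_ring_norm_def by (elim conjE allE[of _ x])

lemma is_ring_norm_mult: "is_ring_norm N \<Longrightarrow> N (x * y) = N x * N y"
  unfolding is_ring_norm_def by blast

lemma is_ring_norm_no_zero_divisors:
  fixes N :: "'a::comm_ring_1 \<Rightarrow> nat" and x y :: 'a
  assumes N: "is_ring_norm N" and xy: "x * y = 0"
  shows "x = 0 \<or> y = 0"
proof -
  have "N (x * y) = 0"
    using N xy by (simp only: is_ring_norm_eq_0_iff)
  hence "N x = 0 \<or> N y = 0"
    by (simp only: is_ring_norm_mult[OF N] mult_eq_0_iff)
  thus ?thesis
    by (simp only: is_ring_norm_eq_0_iff[OF N])
qed

text \<open>
  The multiplicative extension of a norm to the fraction field. The lemma
  \<open>norm_fract_Fract\<close> shows that the description is unique for every norm.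
\<close>

definition norm_fract :: "('a::idom \<Rightarrow> nat) \<Rightarrow> 'a fract \<Rightarrow> rat" where
  "norm_fract N z =
     (THE r. \<exists>x y. y \<noteq> 0 \<and> z = Fract x y \<and> r = of_nat (N x) / of_nat (N y))"

lemma norm_fract_Fract:
  fixes N :: "'a::idom \<Rightarrow> nat"
  assumes N: "is_ring_norm N" and y: "y \<noteq> 0"
  shows "norm_fract N (Fract x y) = of_nat (N x) / of_nat (N y)"
  unfolding norm_fract_def
proof (rule the_equality)
  show "\<exists>x' y'. y' \<noteq> 0 \<and> Fract x y = Fract x' y' \<and>
          of_nat (N x) / of_nat (N y) = (of_nat (N x') / of_nat (N y') :: rat)"
    using y by blast
next
  fix r :: rat
  assume "\<exists>x' y'. y' \<noteq> 0 \<and> Fract x y = Fract x' y' \<and> r = of_nat (N x') / of_nat (N y')"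
  then obtain x' y' where y': "y' \<noteq> 0" and eq: "Fract x y = Fract x' y'"
    and r: "r = of_nat (N x') / of_nat (N y')"
    by blast
  have "x * y' = x' * y"
    using eq y y' by (simp add: eq_fract)
  hence "N (x * y') = N (x' * y)"
    by simp
  hence "N x * N y' = N x' * N y"
    by (simp only: is_ring_norm_mult[OF N])
  hence "(of_nat (N x) * of_nat (N y') :: rat) = of_nat (N x') * of_nat (N y)"
    by (simp only: of_nat_mult[symmetric])
  moreover have "N y \<noteq> 0" "N y' \<noteq> 0"
    using y y' by (simp_all only: is_ring_norm_eq_0_iff[OF N] not_False_eq_True)
  ultimately show "r = of_nat (N x) / of_nat (N y)"
    unfolding r by (simp add: frac_eq_eq)
qed

text \<open>
  A polynomial in variables indexed by the finite type \<open>'n\<close> is a finitely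
  supported map from exponent vectors to coefficients.
\<close>

type_synonym ('n, 'a) mpol = "('n \<Rightarrow>\<^sub>0 nat) \<Rightarrow>\<^sub>0 'a"

definition eval_mpol :: "('n::finite, 'a::comm_ring_1) mpol \<Rightarrow> 'a ^ 'n \<Rightarrow> 'a" where
  "eval_mpol p x =
     (\<Sum>m\<in>Poly_Mapping.keys p.
        Poly_Mapping.lookup p m * (\<Prod>i\<in>UNIV. (x $ i) ^ Poly_Mapping.lookup m i))"

definition quadratic_form :: "('n::finite, 'a::comm_ring_1) mpol \<Rightarrow> bool" where
  "quadratic_form q \<longleftrightarrow>
     (\<forall>m\<in>Poly_Mapping.keys q. (\<Sum>i\<in>UNIV. Poly_Mapping.lookup m i) = 2)"

definition base_change :: "('n::finite, 'a::idom) mpol \<Rightarrow> ('n, 'a fract) mpol" where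
  "base_change q = Poly_Mapping.map to_fract q"

definition to_fract_vec :: "'a::idom ^ 'n \<Rightarrow> 'a fract ^ 'n" where
  "to_fract_vec y = (\<chi> i. to_fract (y $ i))"

text \<open>
  Meaningful in characteristic different from 2 only: otherwise \<open>a / 2 = 0\<close>.
\<close>

definition assoc_bilinear ::
    "('n::finite, 'k::field) mpol \<Rightarrow> 'k ^ 'n \<Rightarrow> 'k ^ 'n \<Rightarrow> 'k" where
  "assoc_bilinear q x y = (eval_mpol q (x + y) - eval_mpol q x - eval_mpol q y) / 2"

definition nondegenerate_form :: "('n::finite, 'k::field) mpol \<Rightarrow> bool" where
  "nondegenerate_form q \<longleftrightarrow> (\<forall>x. (\<forall>y. assoc_bilinear q x y = 0) \<longrightarrow> x = 0)"

definition euclidean_form :: "('a::idom \<Rightarrow> nat) \<Rightarrow> ('n::finite, 'a) mpol \<Rightarrow> bool" where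
  "euclidean_form N q \<longleftrightarrow>
     (\<forall>x :: 'a fract ^ 'n. x \<notin> range to_fract_vec \<longrightarrow>
        (\<exists>y :: 'a ^ 'n.
           0 < norm_fract N (eval_mpol (base_change q) (x - to_fract_vec y)) \<and>
           norm_fract N (eval_mpol (base_change q) (x - to_fract_vec y)) < 1))"

definition ADC_form :: "('n::finite, 'a::idom) mpol \<Rightarrow> bool" where
  "ADC_form q \<longleftrightarrow>
     (\<forall>d :: 'a.
        (\<exists>x :: 'a fract ^ 'n. eval_mpol (base_change q) x = to_fract d) \<longrightarrow>
        (\<exists>y :: 'a ^ 'n. eval_mpol q y = d))"

end

theory Submission
  imports Defs
begin

text \<open>
  The proof is the classical descent of Aubry, Davenport and Cassels, carried out with
  numerators and denominators in \<open>R\<close>. Let \<open>P\<close> be the polar form of \<open>q\<close>, so that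
  \<open>q (a x + b y) = a\<^sup>2 q x + a b P x y + b\<^sup>2 q y\<close>. A point \<open>x / t\<close> with \<open>q (x / t) = d\<close> which is
  not integral has, by the Euclidean property, an integral vector \<open>y\<close> with
  \<open>0 < |q (x / t - y)| < 1\<close>. The line through \<open>y\<close> and \<open>x / t\<close> meets the quadric \<open>q = d\<close> in a second
  point (counted with multiplicity), namely \<open>y + ((q y - d) / q (x / t - y)) (x / t - y)\<close>. Its denominator can be taken to be
  \<open>s = t q (x / t - y) = t d - P x y + t q y\<close>, which lies in \<open>R\<close>, is nonzero, and has norm
  smaller than that of \<open>t\<close>. Since norms are natural numbers, iterating the construction ends at
  an integral point. The lemma \<open>second_intersection\<close> is the algebra of the construction, and
  \<open>descent\<close> is the induction on the norm of the denominator.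

  The polar form does not involve division by 2, and the second intersection point exists
  because \<open>q (x / t - y)\<close> is nonzero.
\<close>

section \<open>Quadratic forms and their polar forms\<close>

lemma prod_power_degree_Suc:
  fixes f :: "'n::finite \<Rightarrow> nat"
  assumes "(\<Sum>i\<in>UNIV. f i) = Suc n"
  obtains i g where "(\<Sum>i\<in>UNIV. g i) = n"
    and "\<And>x :: 'n \<Rightarrow> 'a::comm_monoid_mult. (\<Prod>k\<in>UNIV. x k ^ f k) = x i * (\<Prod>k\<in>UNIV. x k ^ g k)"
proof -
  obtain i where i: "f i \<noteq> 0"
    using assms by (metis nat.distinct(1) sum.neutral)
  define g where "g = f(i := f i - 1)"
  have rest: "(\<Sum>k\<in>UNIV-{i}. g k) = (\<Sum>k\<in>UNIV-{i}. f k)"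
    by (rule sum.cong) (auto simp: g_def)
  have "(\<Sum>k\<in>UNIV. g k) = n"
    using assms i rest sum.remove[of UNIV i f] sum.remove[of UNIV i g] by (simp add: g_def)
  moreover have "(\<Prod>k\<in>UNIV. x k ^ f k) = x i * (\<Prod>k\<in>UNIV. x k ^ g k)" for x :: "'n \<Rightarrow> 'a"
  proof -
    have "(\<Prod>k\<in>UNIV-{i}. x k ^ g k) = (\<Prod>k\<in>UNIV-{i}. x k ^ f k)"
      by (rule prod.cong) (auto simp: g_def)
    moreover have "x i ^ f i = x i * x i ^ g i"
      using i by (simp add: g_def flip: power_Suc)
    ultimately show ?thesis
      by (simp add: prod.remove[of UNIV i "\<lambda>k. x k ^ f k"]
          prod.remove[of UNIV i "\<lambda>k. x k ^ g k"] mult.assoc)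
  qed
  ultimately show thesis
    using that by blast
qed

lemma monomial_degree_2:
  fixes f :: "'n::finite \<Rightarrow> nat"
  assumes "(\<Sum>i\<in>UNIV. f i) = 2"
  shows "\<exists>i j. \<forall>x :: 'n \<Rightarrow> 'a::comm_monoid_mult. (\<Prod>k\<in>UNIV. x k ^ f k) = x i * x j"
proof -
  have "(\<Sum>i\<in>UNIV. f i) = Suc (Suc 0)"
    using assms by simp
  then obtain i g where g: "(\<Sum>i\<in>UNIV. g i) = Suc 0"
    and f: "\<And>x :: 'n \<Rightarrow> 'a. (\<Prod>k\<in>UNIV. x k ^ f k) = x i * (\<Prod>k\<in>UNIV. x k ^ g k)"
    by (rule prod_power_degree_Suc[where ?'a = 'a]) blast
  from g obtain j h where h: "(\<Sum>i\<in>UNIV. h i) = (0::nat)"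
    and g': "\<And>x :: 'n \<Rightarrow> 'a. (\<Prod>k\<in>UNIV. x k ^ g k) = x j * (\<Prod>k\<in>UNIV. x k ^ h k)"
    by (rule prod_power_degree_Suc[where ?'a = 'a]) blast
  from h have "(\<Prod>k\<in>UNIV. x k ^ h k) = 1" for x :: "'n \<Rightarrow> 'a"
    by simp
  thus ?thesis
    using f g' by (metis mult.right_neutral)
qed

lemma quadratic_form_polar:
  fixes q :: "('n::finite, 'a::comm_ring_1) mpol"
  assumes "quadratic_form q"
  obtains P where "\<And>a b x y. eval_mpol q (a *s x + b *s y) =
    a\<^sup>2 * eval_mpol q x + a * b * P x y + b\<^sup>2 * eval_mpol q y"
proof -
  have "\<forall>m\<in>Poly_Mapping.keys q. \<exists>ij. \<forall>x :: 'n \<Rightarrow> 'a.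
      (\<Prod>k\<in>UNIV. x k ^ Poly_Mapping.lookup m k) = x (fst ij) * x (snd ij)"
    using assms monomial_degree_2 unfolding quadratic_form_def by fastforce
  then obtain ij where ij: "\<And>m (x :: 'n \<Rightarrow> 'a). m \<in> Poly_Mapping.keys q \<Longrightarrow>
      (\<Prod>k\<in>UNIV. x k ^ Poly_Mapping.lookup m k) = x (fst (ij m)) * x (snd (ij m))"
    by metis
  let ?c = "Poly_Mapping.lookup q" and ?i = "\<lambda>m. fst (ij m)" and ?j = "\<lambda>m. snd (ij m)"
  have eval: "eval_mpol q x = (\<Sum>m\<in>Poly_Mapping.keys q. ?c m * (x $ ?i m * x $ ?j m))" for x
    unfolding eval_mpol_def by (rule sum.cong) (simp_all add: ij)
  define P where "P x y = (\<Sum>m\<in>Poly_Mapping.keys q.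
      ?c m * (x $ ?i m * y $ ?j m + y $ ?i m * x $ ?j m))" for x y
  have "eval_mpol q (a *s x + b *s y) =
      a\<^sup>2 * eval_mpol q x + a * b * P x y + b\<^sup>2 * eval_mpol q y" for a b x y
    unfolding eval P_def sum_distrib_left sum.distrib[symmetric]
    by (rule sum.cong) (simp_all add: algebra_simps power2_eq_square)
  thus thesis
    using that by blast
qed

lemma quadratic_form_scale:
  assumes "quadratic_form q"
  shows "eval_mpol q (a *s x) = a\<^sup>2 * eval_mpol q x"
proof -
  obtain P where "\<And>a b x y. eval_mpol q (a *s x + b *s y) =
      a\<^sup>2 * eval_mpol q x + a * b * P x y + b\<^sup>2 * eval_mpol q y"
    using quadratic_form_polar[OF assms] by blast
  from this[of a x 0 0] show ?thesis
    by simp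
qed

text \<open>
  For \<open>t\<close> and \<open>s\<close> nonzero and \<open>z = x / t - y\<close>, the first equation says \<open>q z = s / t\<close>, and the second that
  \<open>y + ((q y - d) / q z) z\<close> lies on the quadric \<open>q = d\<close>, both with denominators cleared.
\<close>

lemma second_intersection:
  fixes q :: "('n::finite, 'a::comm_ring_1) mpol"
  assumes q: "quadratic_form q" and x: "eval_mpol q x = t\<^sup>2 * d"
  obtains s where "eval_mpol q (x - t *s y) = t * s"
    and "eval_mpol q (s *s y + (eval_mpol q y - d) *s (x - t *s y)) = s\<^sup>2 * d"
proof -
  obtain P where P: "\<And>a b x y. eval_mpol q (a *s x + b *s y) =
      a\<^sup>2 * eval_mpol q x + a * b * P x y + b\<^sup>2 * eval_mpol q y"
    using quadratic_form_polar[OF q] by blast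
  define s where "s = t * d - P x y + t * eval_mpol q y"
  define c where "c = eval_mpol q y - d"
  have "x - t *s y = 1 *s x + (- t) *s y"
    by (simp add: vec_eq_iff)
  hence "eval_mpol q (x - t *s y) = t * s"
    by (simp only: P x s_def) (simp add: algebra_simps power2_eq_square)
  moreover have "s *s y + c *s (x - t *s y) = c *s x + (s - c * t) *s y"
    by (simp add: vec_eq_iff algebra_simps)
  hence "eval_mpol q (s *s y + c *s (x - t *s y)) = s\<^sup>2 * d"
    by (simp only: P x s_def c_def) (simp add: algebra_simps power2_eq_square)
  ultimately show thesis
    using that unfolding c_def by blast
qed

section \<open>Base change to the fraction field\<close>

lemma keys_base_change: "Poly_Mapping.keys (base_change q) = Poly_Mapping.keys q"
  by (auto simp: base_change_def in_keys_iff Poly_Mapping.map.rep_eq when_def)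

lemma quadratic_form_base_change: "quadratic_form q \<Longrightarrow> quadratic_form (base_change q)"
  by (simp add: quadratic_form_def keys_base_change)

lemma to_fract_sum: "to_fract (\<Sum>i\<in>A. f i) = (\<Sum>i\<in>A. to_fract (f i))"
  by (induction A rule: infinite_finite_induct) auto

lemma to_fract_prod: "to_fract (\<Prod>i\<in>A. f i) = (\<Prod>i\<in>A. to_fract (f i))"
  by (induction A rule: infinite_finite_induct) auto

lemma to_fract_power: "to_fract (x ^ k) = to_fract x ^ k"
  by (induction k) auto

lemma eval_base_change:
  "eval_mpol (base_change q) (to_fract_vec v) = to_fract (eval_mpol q v)"
  unfolding eval_mpol_def keys_base_change to_fract_sum
  by (rule sum.cong)
    (auto simp: to_fract_prod to_fract_power to_fract_vec_def base_change_def
      Poly_Mapping.map.rep_eq when_def)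

lemma eval_base_change_quotient:
  assumes "quadratic_form q"
  shows "eval_mpol (base_change q) (inverse (to_fract t) *s to_fract_vec v) =
    to_fract (eval_mpol q v) / (to_fract t)\<^sup>2"
  by (simp add: quadratic_form_scale[OF quadratic_form_base_change[OF assms]] eval_base_change
      power_inverse divide_inverse)

lemma to_fract_vec_diff_scale:
  assumes "t \<noteq> 0"
  shows "inverse (to_fract t) *s to_fract_vec v - to_fract_vec y =
    inverse (to_fract t) *s to_fract_vec (v - t *s y)"
  using assms by (simp add: to_fract_vec_def vec_eq_iff field_simps)

lemma common_denominator:
  fixes x :: "'a::idom fract ^ 'n::finite"
  obtains t v where "t \<noteq> 0" and "x = inverse (to_fract t) *s to_fract_vec v"
proof -
  have "\<forall>i. \<exists>a b. b \<noteq> 0 \<and> x $ i = Fract a b"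
    by (metis Fract_cases)
  then obtain a b where b: "\<And>i. b i \<noteq> 0" and x: "\<And>i. x $ i = Fract (a i) (b i)"
    by metis
  let ?t = "\<Prod>i\<in>UNIV. b i" and ?v = "\<chi> i. a i * (\<Prod>j\<in>UNIV-{i}. b j)"
  have t: "?t \<noteq> 0"
    using b by simp
  have "x $ i = inverse (to_fract ?t) * to_fract (?v $ i)" for i
  proof -
    have eq: "?t = b i * (\<Prod>j\<in>UNIV-{i}. b j)"
      by (rule prod.remove) auto
    have "(\<Prod>j\<in>UNIV-{i}. b j) \<noteq> 0"
      using b by simp
    thus ?thesis
      unfolding x eq using b[of i] by (simp add: Fract_conv_to_fract field_simps)
  qed
  hence "x = inverse (to_fract ?t) *s to_fract_vec ?v"
    by (simp add: vec_eq_iff to_fract_vec_def)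
  with t show thesis
    using that by blast
qed

section \<open>Descent on the denominator\<close>

lemma norm_fract_to_fract_div:
  assumes "is_ring_norm N" and "t \<noteq> 0"
  shows "norm_fract N (to_fract s / to_fract t) = of_nat (N s) / of_nat (N t)"
  using norm_fract_Fract[OF assms, of s] by (simp add: Fract_conv_to_fract)

lemma descent:
  fixes N :: "'a::idom \<Rightarrow> nat" and q :: "('n::finite, 'a) mpol"
  assumes N: "is_ring_norm N" and q: "quadratic_form q" and E: "euclidean_form N q"
  shows "t \<noteq> 0 \<Longrightarrow> eval_mpol q x = t\<^sup>2 * d \<Longrightarrow> \<exists>y. eval_mpol q y = d"
proof (induction "N t" arbitrary: t x rule: less_induct)
  case less
  note t = less.prems(1) and x = less.prems(2)
  let ?z = "inverse (to_fract t) *s to_fract_vec x"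
  show ?case
  proof (cases "?z \<in> range to_fract_vec")
    case True
    then obtain y where y: "?z = to_fract_vec y"
      by blast
    have "to_fract (eval_mpol q y) = eval_mpol (base_change q) ?z"
      by (simp add: y eval_base_change)
    also have "\<dots> = to_fract d"
      using t by (simp add: eval_base_change_quotient[OF q] x to_fract_power)
    finally show ?thesis
      by auto
  next
    case False
    then obtain y where y:
      "0 < norm_fract N (eval_mpol (base_change q) (?z - to_fract_vec y))"
      "norm_fract N (eval_mpol (base_change q) (?z - to_fract_vec y)) < 1"
      using E unfolding euclidean_form_def by blast
    obtain s where s: "eval_mpol q (x - t *s y) = t * s"
      and s': "eval_mpol q (s *s y + (eval_mpol q y - d) *s (x - t *s y)) = s\<^sup>2 * d"
      using second_intersection[OF q x] by blast
    have "eval_mpol (base_change q) (?z - to_fract_vec y) = to_fract s / to_fract t"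
      using t by (simp add: to_fract_vec_diff_scale eval_base_change_quotient[OF q] s
          power2_eq_square)
    with y have *: "0 < (of_nat (N s) / of_nat (N t) :: rat)"
      "(of_nat (N s) / of_nat (N t) :: rat) < 1"
      by (simp_all only: norm_fract_to_fract_div[OF N t])
    have "N t > 0"
      using t is_ring_norm_eq_0_iff[OF N, of t] by simp
    with * have "N s > 0" "N s < N t"
      by (simp_all add: zero_less_divide_iff divide_less_eq)
    moreover from \<open>N s > 0\<close> have "s \<noteq> 0"
      using is_ring_norm_eq_0_iff[OF N, of s] by auto
    ultimately show ?thesis
      using less.hyps[OF _ _ s'] by blast
  qed
qed

theorem theorem8:
  fixes N :: "'a::idom \<Rightarrow> nat"
    and q :: "('n::finite, 'a) mpol"
  assumes "is_ring_norm N"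
    and "CHAR('a) \<noteq> 2"
    and "quadratic_form q"
    and "nondegenerate_form (base_change q)"
    and "euclidean_form N q"
  shows "ADC_form q"
  unfolding ADC_form_def
proof (intro allI impI)
  fix d :: 'a
  assume "\<exists>x :: 'a fract ^ 'n. eval_mpol (base_change q) x = to_fract d"
  then obtain x :: "'a fract ^ 'n" where x: "eval_mpol (base_change q) x = to_fract d"
    by blast
  obtain t v where t: "t \<noteq> 0" and xv: "x = inverse (to_fract t) *s to_fract_vec v"
    by (rule common_denominator)
  have "to_fract (eval_mpol q v) / (to_fract t)\<^sup>2 = to_fract d"
    using x unfolding xv eval_base_change_quotient[OF assms(3)] .
  hence "to_fract (eval_mpol q v) = to_fract (t\<^sup>2 * d)"
    using t by (simp add: field_simps to_fract_power)
  hence "eval_mpol q v = t\<^sup>2 * d"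
    by (simp only: to_fract_eq_iff)
  with t show "\<exists>y. eval_mpol q y = d"
    by (rule descent[OF assms(1,3,5)])
qed

end
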